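(* Let $d\geq 3$, $\Omega=\{1,\ldots,d\}$, and let $F<F'<\mathrm{Sym}(\Omega)$ be permutation groups such that $F'$ preserves the orbits of $F$. If $F'$ does not act 2-transitively on $\Omega$, then $H^2_{\mathrm{cb}}(G(F,F');\mathbb{R})$ is infinite dimensional.
   Context: Let $T=\mathcal{T}_d$ be the $d$-regular tree, with vertex set $V(T)$ and set of (unoriented) edges $E(T)$. Fix a coloring $c\colon E(T)\to\Omega$ such that for every vertex $v$ the restriction $c_v$ of $c$ to the set $E(v)$ of edges containing $v$ is a bijection $E(v)\to\Omega$. For $g\in\mathrm{Aut}(T)$ and $v\in V(T)$ let $g_v\colon E(v)\to E(gv)$ be the induced bijection and define the local permutation $\sigma(g,v)=c_{gv}\circ g_v\circ c_v^{-1}\in\mathrm{Sym}(\Omega)$. For $F\le \mathrm{Sym}(\Omega)$ let $U(F)=\{g\in\mathrm{Aut}(T):\sigma(g,v)\in F \text{ for all } v\}$ and $G(F)=\{g\in \mathrm{Aut}(T): \sigma(g,v)\in F \text{ for all but finitely many } v\}$. For $F\le F'$ with $F'$ preserving the orbits of $F$, set $G(F,F')=G(F)\cap U(F')$, endowed with the unique group topology for which the inclusion $U(F)\hookrightarrow G(F,F')$ is continuous and open ($U(F)$ carrying the pointwise convergence topology from $\mathrm{Aut}(T)$); it is a totally disconnected locally compact group. $H^2_{\mathrm{cb}}(G;\mathbb{R})$ denotes the second continuous bounded cohomology with trivial real coefficients (cohomology of the complex of $G$-invariant continuous bounded functions on $G^{n+1}$ with the homogeneous coboundary). *)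

theory Defs
  imports "HOL-Analysis.Analysis" "HOL-Combinatorics.Permutations"
begin

text \<open>Vertices: reduced words over Omega = {1..d} (no two consecutive letters equal).
  The edges are {w, w @ [i]}; the edge {w, w @ [i]} has colour i.
  Every vertex sees each colour of Omega exactly once: this is a legal colouring.\<close>

type_synonym vert = "nat list"

definition tree_V :: "nat \<Rightarrow> vert set" where
  "tree_V d = {w. set w \<subseteq> {1..d} \<and> (\<forall>i. Suc i < length w \<longrightarrow> w ! i \<noteq> w ! Suc i)}"

definition tree_adj :: "nat \<Rightarrow> vert \<Rightarrow> vert \<Rightarrow> bool" where
  "tree_adj d u v \<longleftrightarrow> u \<in> tree_V d \<and> v \<in> tree_V d \<and> (\<exists>i. v = u @ [i] \<or> u = v @ [i])"

definition edge_col :: "vert \<Rightarrow> vert \<Rightarrow> nat" where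
  "edge_col u v = (if length u < length v then last v else last u)"

text \<open>The neighbour of v along the edge of colour i, i.e. the other endpoint of c_v^{-1}(i).\<close>
definition nbr :: "vert \<Rightarrow> nat \<Rightarrow> vert" where
  "nbr v i = (if v \<noteq> [] \<and> last v = i then butlast v else v @ [i])"

text \<open>Aut(T): adjacency-preserving bijections of the vertex set (taken to be the identity
  outside the vertex set, so that they are determined by their action on vertices).\<close>
definition tree_aut :: "nat \<Rightarrow> (vert \<Rightarrow> vert) set" where
  "tree_aut d = {g. bij_betw g (tree_V d) (tree_V d)
       \<and> (\<forall>u\<in>tree_V d. \<forall>v\<in>tree_V d. tree_adj d (g u) (g v) \<longleftrightarrow> tree_adj d u v)
       \<and> (\<forall>w. w \<notin> tree_V d \<longrightarrow> g w = w)}"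

text \<open>Local permutation sigma(g,v) = c_{gv} o g_v o c_v^{-1}, as a permutation of {1..d}.\<close>
definition local_perm :: "nat \<Rightarrow> (vert \<Rightarrow> vert) \<Rightarrow> vert \<Rightarrow> nat \<Rightarrow> nat" where
  "local_perm d g v = (\<lambda>i. if i \<in> {1..d} then edge_col (g v) (g (nbr v i)) else i)"

definition Sym :: "nat \<Rightarrow> (nat \<Rightarrow> nat) set" where
  "Sym d = {p. p permutes {1..d}}"

definition perm_subgroup :: "nat \<Rightarrow> (nat \<Rightarrow> nat) set \<Rightarrow> bool" where
  "perm_subgroup d F \<longleftrightarrow> F \<subseteq> Sym d \<and> id \<in> F \<and> (\<forall>p\<in>F. \<forall>q\<in>F. p \<circ> q \<in> F)
      \<and> (\<forall>p\<in>F. inv p \<in> F)"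

definition preserves_orbits :: "nat \<Rightarrow> (nat \<Rightarrow> nat) set \<Rightarrow> (nat \<Rightarrow> nat) set \<Rightarrow> bool" where
  "preserves_orbits d F F' \<longleftrightarrow> (\<forall>p\<in>F'. \<forall>x\<in>{1..d}. \<exists>q\<in>F. p x = q x)"

definition two_transitive :: "nat \<Rightarrow> (nat \<Rightarrow> nat) set \<Rightarrow> bool" where
  "two_transitive d F \<longleftrightarrow> (\<forall>x\<in>{1..d}. \<forall>y\<in>{1..d}. \<forall>x'\<in>{1..d}. \<forall>y'\<in>{1..d}.
      x \<noteq> y \<longrightarrow> x' \<noteq> y' \<longrightarrow> (\<exists>p\<in>F. p x = x' \<and> p y = y'))"

definition U_grp :: "nat \<Rightarrow> (nat \<Rightarrow> nat) set \<Rightarrow> (vert \<Rightarrow> vert) set" where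
  "U_grp d F = {g \<in> tree_aut d. \<forall>v\<in>tree_V d. local_perm d g v \<in> F}"

definition G_grp :: "nat \<Rightarrow> (nat \<Rightarrow> nat) set \<Rightarrow> (vert \<Rightarrow> vert) set" where
  "G_grp d F = {g \<in> tree_aut d. finite {v \<in> tree_V d. local_perm d g v \<notin> F}}"

definition GFF :: "nat \<Rightarrow> (nat \<Rightarrow> nat) set \<Rightarrow> (nat \<Rightarrow> nat) set \<Rightarrow> (vert \<Rightarrow> vert) set" where
  "GFF d F F' = G_grp d F \<inter> U_grp d F'"

text \<open>The group topology on G(F,F') for which U(F) (with the pointwise convergence
  topology) is an open subgroup: a basis of identity neighbourhoods is given by the
  pointwise stabilisers in U(F) of finite vertex sets.\<close>
definition GFF_topology :: "nat \<Rightarrow> (nat \<Rightarrow> nat) set \<Rightarrow> (nat \<Rightarrow> nat) set \<Rightarrow> (vert \<Rightarrow> vert) topology" where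
  "GFF_topology d F F' = topology (\<lambda>S. S \<subseteq> GFF d F F' \<and>
     (\<forall>g\<in>S. \<exists>A. finite A \<and> A \<subseteq> tree_V d \<and>
        (\<forall>h\<in>U_grp d F. (\<forall>a\<in>A. h a = a) \<longrightarrow> g \<circ> h \<in> S)))"

text \<open>A topological group is given by its topology X (carrier = topspace X) and
  multiplication gmul. Homogeneous complex of invariant continuous bounded functions.\<close>

definition cb_cochain1 :: "'g topology \<Rightarrow> ('g \<Rightarrow> 'g \<Rightarrow> 'g) \<Rightarrow> ('g \<times> 'g \<Rightarrow> real) set" where
  "cb_cochain1 X gmul = {\<phi>. continuous_map (prod_topology X X) euclideanreal \<phi>
     \<and> bounded (\<phi> ` (topspace X \<times> topspace X))
     \<and> (\<forall>g\<in>topspace X. \<forall>x0\<in>topspace X. \<forall>x1\<in>topspace X.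
          \<phi> (gmul g x0, gmul g x1) = \<phi> (x0, x1))}"

definition cb_cochain2 :: "'g topology \<Rightarrow> ('g \<Rightarrow> 'g \<Rightarrow> 'g) \<Rightarrow> ('g \<times> 'g \<times> 'g \<Rightarrow> real) set" where
  "cb_cochain2 X gmul = {f. continuous_map (prod_topology X (prod_topology X X)) euclideanreal f
     \<and> bounded (f ` (topspace X \<times> topspace X \<times> topspace X))
     \<and> (\<forall>g\<in>topspace X. \<forall>x0\<in>topspace X. \<forall>x1\<in>topspace X. \<forall>x2\<in>topspace X.
          f (gmul g x0, gmul g x1, gmul g x2) = f (x0, x1, x2))}"

definition cobd1 :: "('g \<times> 'g \<Rightarrow> real) \<Rightarrow> ('g \<times> 'g \<times> 'g \<Rightarrow> real)" where
  "cobd1 \<phi> = (\<lambda>(x0, x1, x2). \<phi> (x1, x2) - \<phi> (x0, x2) + \<phi> (x0, x1))"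

definition cb_cocycle2 :: "'g topology \<Rightarrow> ('g \<Rightarrow> 'g \<Rightarrow> 'g) \<Rightarrow> ('g \<times> 'g \<times> 'g \<Rightarrow> real) set" where
  "cb_cocycle2 X gmul = {f \<in> cb_cochain2 X gmul.
     \<forall>x0\<in>topspace X. \<forall>x1\<in>topspace X. \<forall>x2\<in>topspace X. \<forall>x3\<in>topspace X.
       f (x1, x2, x3) - f (x0, x2, x3) + f (x0, x1, x3) - f (x0, x1, x2) = 0}"

text \<open>H^2_cb = Z^2/B^2 is infinite dimensional: for every n there are n cocycles which are
  linearly independent modulo the coboundaries (equality of cochains on G^3).\<close>
definition H2cb_infinite_dim :: "'g topology \<Rightarrow> ('g \<Rightarrow> 'g \<Rightarrow> 'g) \<Rightarrow> bool" where
  "H2cb_infinite_dim X gmul \<longleftrightarrow>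
    (\<forall>n::nat. \<exists>f :: nat \<Rightarrow> ('g \<times> 'g \<times> 'g \<Rightarrow> real).
       (\<forall>i<n. f i \<in> cb_cocycle2 X gmul) \<and>
       (\<forall>c :: nat \<Rightarrow> real.
          (\<exists>\<phi>\<in>cb_cochain1 X gmul. \<forall>x\<in>topspace X \<times> topspace X \<times> topspace X.
              (\<Sum>i<n. c i * f i x) = cobd1 \<phi> x)
          \<longrightarrow> (\<forall>i<n. c i = 0)))"

end

theory Submission
  imports Defs
begin

text \<open>
  Stabilisers of vertices in \<open>U(F)\<close> are open in \<open>G(F,F')\<close>, so a \<open>U(F')\<close>-invariant function of
  pairs of vertices with bounded coboundary gives a continuous bounded 2-cocycle on \<open>G(F,F')\<close>.
  Brooks counting provides such functions: reading the colours along a geodesic, mark three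
  consecutive colours \<open>i, j, k\<close> if \<open>i\<close> and \<open>k\<close> lie in different orbits of the stabiliser of \<open>j\<close>
  in \<open>F'\<close>. This is invariant under \<open>U(F')\<close> and under reversing the geodesic. Count a pattern of
  marks minus the reversed pattern. Since \<open>d \<ge> 3\<close> and \<open>F'\<close> is not 2-transitive, some \<open>a, b, c\<close>
  are marked, and then the words \<open>x\<^sub>0 b x\<^sub>1 b x\<^sub>2 b \<dots>\<close> with \<open>x\<^sub>s\<close> in \<open>{a, c}\<close> realise every pattern
  on their even positions. Finally \<open>U(1)\<close>, the free product of \<open>d\<close> copies of \<open>Z/2\<close>, is contained
  in \<open>G(F,F')\<close> and has no nonzero homomorphism to the reals, so a linear combination of the
  cocycles can be a coboundary only if the combination of the counting functions is bounded on
  all words.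
\<close>

subsection \<open>The tree as a free product\<close>

lemma tree_V_distinct_adj: "w \<in> tree_V d \<longleftrightarrow> set w \<subseteq> {1..d} \<and> distinct_adj w"
  by (auto simp: tree_V_def distinct_adj_conv_nth)

lemma Nil_in_tree_V [simp]: "[] \<in> tree_V d"
  by (simp add: tree_V_def)

lemma rev_in_tree_V [simp]: "rev w \<in> tree_V d \<longleftrightarrow> w \<in> tree_V d"
  by (simp add: tree_V_distinct_adj)

lemma butlast_in_tree_V: "w \<in> tree_V d \<Longrightarrow> butlast w \<in> tree_V d"
  by (cases w rule: rev_cases) (auto simp: tree_V_distinct_adj distinct_adj_append_iff)

lemma snoc_in_tree_V:
  "w @ [i] \<in> tree_V d \<longleftrightarrow> w \<in> tree_V d \<and> i \<in> {1..d} \<and> (w = [] \<or> last w \<noteq> i)"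
  by (auto simp: tree_V_distinct_adj distinct_adj_append_iff)

lemma nbr_in_tree_V: "v \<in> tree_V d \<Longrightarrow> i \<in> {1..d} \<Longrightarrow> nbr v i \<in> tree_V d"
  by (auto simp: nbr_def butlast_in_tree_V snoc_in_tree_V)

lemma nbr_nbr: "v \<in> tree_V d \<Longrightarrow> nbr (nbr v i) i = v"
  by (cases v rule: rev_cases) (auto simp: nbr_def snoc_in_tree_V butlast_append)

lemma nbr_snoc [simp]: "nbr (v @ [i]) i = v"
  by (simp add: nbr_def)

lemma edge_col_nbr: "edge_col v (nbr v i) = i"
  by (auto simp: edge_col_def nbr_def)

lemma tree_adjE:
  assumes "tree_adj d u v"
  obtains i where "u \<in> tree_V d" "v \<in> tree_V d" "v = u @ [i]"
    | i where "u \<in> tree_V d" "v \<in> tree_V d" "u = v @ [i]"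
  using assms unfolding tree_adj_def by blast

lemma edge_col_commute: "tree_adj d u v \<Longrightarrow> edge_col u v = edge_col v u"
  by (erule tree_adjE) (simp_all add: edge_col_def)

lemma tree_adj_iff_nbr:
  "tree_adj d u v \<longleftrightarrow> u \<in> tree_V d \<and> (\<exists>i\<in>{1..d}. v = nbr u i)"
proof
  assume "tree_adj d u v"
  then show "u \<in> tree_V d \<and> (\<exists>i\<in>{1..d}. v = nbr u i)"
  proof (cases rule: tree_adjE)
    case (1 i)
    then have "i \<in> {1..d} \<and> v = nbr u i"
      by (auto simp: snoc_in_tree_V nbr_def)
    with 1 show ?thesis
      by blast
  next
    case (2 i)
    then have "i \<in> {1..d} \<and> v = nbr u i"
      by (simp add: snoc_in_tree_V)
    with 2 show ?thesis
      by blast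
  qed
next
  assume "u \<in> tree_V d \<and> (\<exists>i\<in>{1..d}. v = nbr u i)"
  then obtain i where i: "u \<in> tree_V d" "i \<in> {1..d}" "v = nbr u i"
    by blast
  then have "v \<in> tree_V d"
    by (simp only: nbr_in_tree_V)
  moreover have "v = u @ [i] \<or> u = v @ [i]"
    unfolding i(3) nbr_def by (cases u rule: rev_cases) simp_all
  ultimately show "tree_adj d u v"
    using i(1) unfolding tree_adj_def by blast
qed

lemma nbr_edge_col: "tree_adj d u v \<Longrightarrow> nbr u (edge_col u v) = v"
  by (auto simp: tree_adj_iff_nbr edge_col_nbr)

text \<open>A vertex, being a reduced word, is an element of the free product of \<open>d\<close> copies of
  \<open>Z/2\<close>; this is its multiplication, with inverse \<^const>\<open>rev\<close>.\<close>

definition mul :: "vert \<Rightarrow> vert \<Rightarrow> vert" where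
  "mul u w = foldl nbr u w"

lemma mul_Nil [simp]: "mul u [] = u"
  and mul_snoc [simp]: "mul u (w @ [i]) = nbr (mul u w) i"
  and mul_Cons: "mul u (i # w) = mul (nbr u i) w"
  by (simp_all add: mul_def)

lemma mul_in_tree_V: "u \<in> tree_V d \<Longrightarrow> set w \<subseteq> {1..d} \<Longrightarrow> mul u w \<in> tree_V d"
  by (induction w rule: rev_induct) (auto simp: nbr_in_tree_V)

lemma mul_tree_V: "u \<in> tree_V d \<Longrightarrow> w \<in> tree_V d \<Longrightarrow> mul u w \<in> tree_V d"
  by (simp add: mul_in_tree_V tree_V_distinct_adj[of w])

lemma mul_eq_append: "u @ w \<in> tree_V d \<Longrightarrow> mul u w = u @ w"
proof (induction w rule: rev_induct)
  case (snoc i w)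
  then have uw: "(u @ w) @ [i] \<in> tree_V d"
    by simp
  then have "mul u w = u @ w" "u @ w = [] \<or> last (u @ w) \<noteq> i"
    using snoc.IH unfolding snoc_in_tree_V by blast+
  then show ?case
    by (auto simp: nbr_def)
qed simp

lemma mul_Nil_left [simp]: "w \<in> tree_V d \<Longrightarrow> mul [] w = w"
  using mul_eq_append[of "[]" w] by simp

text \<open>Right multiplication by the letter \<open>i\<close> is the involution
  \<open>nbr _ i\<close> (\<open>nbr_nbr\<close>), so deleting a last letter \<open>i\<close> of
  \<open>w\<close> has the same effect on the product as multiplying by \<open>i\<close> once
  more.\<close>

lemma mul_nbr:
  assumes "u \<in> tree_V d" "w \<in> tree_V d"
  shows "mul u (nbr w i) = nbr (mul u w) i"
proof (cases "w \<noteq> [] \<and> last w = i")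
  case True
  then have w: "w = butlast w @ [i]"
    by (metis append_butlast_last_id)
  have "mul u (butlast w) \<in> tree_V d"
    using assms by (simp add: mul_tree_V butlast_in_tree_V)
  moreover have "mul u w = nbr (mul u (butlast w)) i"
    by (subst w) simp
  ultimately show ?thesis
    using True by (simp add: nbr_nbr nbr_def[of w])
next
  case False
  then have "nbr w i = w @ [i]"
    by (auto simp: nbr_def)
  then show ?thesis
    by simp
qed

lemma mul_assoc:
  assumes "u \<in> tree_V d" "v \<in> tree_V d" "w \<in> tree_V d"
  shows "mul u (mul v w) = mul (mul u v) w"
  using assms(3)
proof (induction w rule: rev_induct)
  case (snoc i w)
  then show ?case
    using assms(1,2) by (simp add: mul_nbr[of _ d] mul_tree_V snoc_in_tree_V)
qed simp

lemma mul_rev_right: "w \<in> tree_V d \<Longrightarrow> mul w (rev w) = []"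
proof (induction w rule: rev_induct)
  case (snoc i w)
  then show ?case
    by (simp add: mul_Cons snoc_in_tree_V)
qed simp

lemma mul_rev_left: "w \<in> tree_V d \<Longrightarrow> mul (rev w) w = []"
  using mul_rev_right[of "rev w" d] by simp

lemma mul_rev_cancel:
  "u \<in> tree_V d \<Longrightarrow> w \<in> tree_V d \<Longrightarrow> mul u (mul (rev u) w) = w"
  "u \<in> tree_V d \<Longrightarrow> w \<in> tree_V d \<Longrightarrow> mul (rev u) (mul u w) = w"
  using mul_assoc[of u d "rev u" w] mul_assoc[of "rev u" d u w] mul_rev_left[of u d] mul_rev_right[of u d]
  by simp_all

text \<open>Once the common prefix \<open>p\<close> has cancelled letter by letter,
  \<open>rev a @ b\<close> is reduced. It is the word of colours read along the geodesic from
  \<open>u\<close> to \<open>v\<close>: back along \<open>a\<close>, then out along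
  \<open>b\<close>.\<close>

lemma mul_rev_decomp:
  assumes "u \<in> tree_V d" "v \<in> tree_V d"
  obtains p a b where "u = p @ a" "v = p @ b" "mul (rev u) v = rev a @ b"
proof -
  have "\<exists>p a b. u = p @ a \<and> v = p @ b \<and> mul (rev u) v = rev a @ b"
    using assms
  proof (induction u arbitrary: v)
    case Nil
    then show ?case by simp
  next
    case (Cons x u)
    show ?case
    proof (cases "v \<noteq> [] \<and> hd v = x")
      case True
      then obtain v' where v: "v = x # v'"
        by (cases v) auto
      have "u \<in> tree_V d" "v' \<in> tree_V d"
        using Cons.prems v by (auto simp: tree_V_distinct_adj distinct_adj_Cons)
      then obtain p a b where "u = p @ a" "v' = p @ b" "mul (rev u) v' = rev a @ b"
        using Cons.IH by blast
      moreover have "mul (rev (x # u)) v = mul (rev u) v'"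
        by (simp add: v mul_Cons)
      ultimately have "x # u = (x # p) @ a" "v = (x # p) @ b" "mul (rev (x # u)) v = rev a @ b"
        by (simp_all only: v append_Cons)
      then show ?thesis by blast
    next
      case False
      have "rev (x # u) \<in> tree_V d"
        using Cons.prems by (simp only: rev_in_tree_V)
      then have "rev (x # u) @ v \<in> tree_V d"
        using Cons.prems False by (auto simp: tree_V_distinct_adj distinct_adj_append_iff distinct_adj_Cons)
      then have "mul (rev (x # u)) v = rev (x # u) @ v"
        by (rule mul_eq_append)
      then have "x # u = [] @ x # u \<and> v = [] @ v \<and> mul (rev (x # u)) v = rev (x # u) @ v"
        by simp
      then show ?thesis by blast
    qed
  qed
  then show ?thesis using that by blast
qed

subsection \<open>Automorphisms and local permutations\<close>

text \<open>Both ends of an edge see the same colour. Hence the local permutations at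
  \<open>v\<close> and \<open>nbr v i\<close> agree at \<open>i\<close>, which links consecutive
  vertices of a path.\<close>

lemma aut_nbr:
  assumes g: "g \<in> tree_aut d" and v: "v \<in> tree_V d" and i: "i \<in> {1..d}"
  shows "g (nbr v i) = nbr (g v) (local_perm d g v i)"
    and "local_perm d g (nbr v i) i = local_perm d g v i"
    and "local_perm d g v i \<in> {1..d}"
proof -
  have "tree_adj d v (nbr v i)"
    using v i by (auto simp: tree_adj_iff_nbr)
  then have adj: "tree_adj d (g v) (g (nbr v i))"
    using g v i by (auto simp: tree_aut_def nbr_in_tree_V)
  show "g (nbr v i) = nbr (g v) (local_perm d g v i)"
    using nbr_edge_col[OF adj] i by (simp add: local_perm_def)
  show "local_perm d g (nbr v i) i = local_perm d g v i"
    using edge_col_commute[OF adj] i v by (simp add: local_perm_def nbr_nbr)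
  show "local_perm d g v i \<in> {1..d}"
    using adj i by (auto simp: local_perm_def tree_adj_iff_nbr edge_col_nbr)
qed

lemma aut_tree_V: "g \<in> tree_aut d \<Longrightarrow> v \<in> tree_V d \<Longrightarrow> g v \<in> tree_V d"
  by (auto simp: tree_aut_def bij_betw_def)

lemma local_perm_comp:
  assumes "g \<in> tree_aut d" "h \<in> tree_aut d" "v \<in> tree_V d"
  shows "local_perm d (g \<circ> h) v = local_perm d g (h v) \<circ> local_perm d h v"
proof
  fix i
  show "local_perm d (g \<circ> h) v i = (local_perm d g (h v) \<circ> local_perm d h v) i"
  proof (cases "i \<in> {1..d}")
    case True
    have "edge_col (g (h v)) (g (nbr (h v) (local_perm d h v i)))
        = local_perm d g (h v) (local_perm d h v i)"
      using aut_nbr(3)[OF assms(2,3) True] by (simp add: local_perm_def)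
    then show ?thesis
      using True aut_nbr(1)[OF assms(2,3) True] by (simp add: local_perm_def[of d "g \<circ> h"])
  qed (auto simp: local_perm_def)
qed

lemma tree_aut_comp: "g \<in> tree_aut d \<Longrightarrow> h \<in> tree_aut d \<Longrightarrow> g \<circ> h \<in> tree_aut d"
  by (auto simp: tree_aut_def intro: bij_betw_trans) (metis bij_betwE)+

text \<open>Left translation in the free product, extended by the identity off the tree as
  \<open>tree_aut\<close> demands.\<close>

definition left_mul :: "nat \<Rightarrow> vert \<Rightarrow> vert \<Rightarrow> vert" where
  "left_mul d a w = (if w \<in> tree_V d then mul a w else w)"

lemma left_mul_Nil [simp]: "left_mul d a [] = a"
  by (simp add: left_mul_def)

lemma left_mul_Nil_eq_id: "left_mul d [] = id"
  by (auto simp: left_mul_def)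

lemma left_mul_comp:
  "a \<in> tree_V d \<Longrightarrow> b \<in> tree_V d \<Longrightarrow> left_mul d a \<circ> left_mul d b = left_mul d (mul a b)"
  by (auto simp: left_mul_def mul_tree_V mul_assoc)

lemma left_mul_adj:
  "a \<in> tree_V d \<Longrightarrow> tree_adj d u v \<Longrightarrow> tree_adj d (mul a u) (mul a v)"
  by (auto simp: tree_adj_iff_nbr mul_tree_V mul_nbr)

lemma left_mul_aut:
  assumes a: "a \<in> tree_V d"
  shows "left_mul d a \<in> tree_aut d"
proof -
  have "bij_betw (left_mul d a) (tree_V d) (tree_V d)"
    by (rule bij_betw_byWitness[where f' = "mul (rev a)"])
      (use a in \<open>auto simp: left_mul_def mul_tree_V mul_rev_cancel\<close>)
  moreover have "tree_adj d (mul a u) (mul a v) \<longleftrightarrow> tree_adj d u v"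
    if "u \<in> tree_V d" "v \<in> tree_V d" for u v
    using left_mul_adj[OF a, of u v] left_mul_adj[of "rev a" d "mul a u" "mul a v"] a that
    by (auto simp: mul_rev_cancel)
  ultimately show ?thesis
    by (auto simp: tree_aut_def left_mul_def)
qed

text \<open>Left translations commute with the right multiplications \<open>nbr _ i\<close>, so they
  preserve all colours.\<close>

lemma local_perm_left_mul:
  assumes "a \<in> tree_V d" "v \<in> tree_V d"
  shows "local_perm d (left_mul d a) v = id"
  using assms by (auto simp: local_perm_def left_mul_def nbr_in_tree_V mul_nbr edge_col_nbr)

lemma left_mul_U_grp: "a \<in> tree_V d \<Longrightarrow> id \<in> F \<Longrightarrow> left_mul d a \<in> U_grp d F"
  by (simp add: U_grp_def left_mul_aut local_perm_left_mul)

lemma perm_subgroup_comp: "perm_subgroup d F \<Longrightarrow> p \<in> F \<Longrightarrow> q \<in> F \<Longrightarrow> p \<circ> q \<in> F"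
  and perm_subgroup_inv: "perm_subgroup d F \<Longrightarrow> p \<in> F \<Longrightarrow> inv p \<in> F"
  and perm_subgroup_id: "perm_subgroup d F \<Longrightarrow> id \<in> F"
  and perm_subgroup_permutes: "perm_subgroup d F \<Longrightarrow> p \<in> F \<Longrightarrow> p permutes {1..d}"
  by (auto simp: perm_subgroup_def Sym_def)

text \<open>By the chain rule for local permutations, \<open>h\<close> maps every vertex that is bad
  for the composite to one that is bad for \<open>g\<close>, and \<open>h\<close> is injective. Open
  sets are described by such right translates.\<close>

lemma GFF_comp_U_grp:
  assumes F: "perm_subgroup d F" and F': "perm_subgroup d F'" and sub: "F \<subseteq> F'"
    and g: "g \<in> GFF d F F'" and h: "h \<in> U_grp d F"
  shows "g \<circ> h \<in> GFF d F F'"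
proof -
  have aut: "g \<in> tree_aut d" "h \<in> tree_aut d"
    using g h by (auto simp: GFF_def G_grp_def U_grp_def)
  have inj: "inj_on h (tree_V d)"
    using aut(2) by (auto simp: tree_aut_def bij_betw_def)
  have "finite (h -` {v \<in> tree_V d. local_perm d g v \<notin> F} \<inter> tree_V d)"
    using g inj by (intro finite_vimage_IntI) (auto simp: GFF_def G_grp_def)
  moreover have "{v \<in> tree_V d. local_perm d (g \<circ> h) v \<notin> F}
      \<subseteq> h -` {v \<in> tree_V d. local_perm d g v \<notin> F} \<inter> tree_V d"
  proof
    fix v assume v: "v \<in> {v \<in> tree_V d. local_perm d (g \<circ> h) v \<notin> F}"
    then have "local_perm d h v \<in> F" "local_perm d g (h v) \<circ> local_perm d h v \<notin> F" "h v \<in> tree_V d"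
      using h local_perm_comp[OF aut, of v] aut_tree_V[OF aut(2)] by (simp_all add: U_grp_def)
    then show "v \<in> h -` {v \<in> tree_V d. local_perm d g v \<notin> F} \<inter> tree_V d"
      using v perm_subgroup_comp[OF F] by blast
  qed
  ultimately have "finite {v \<in> tree_V d. local_perm d (g \<circ> h) v \<notin> F}"
    by (rule finite_subset[rotated])
  then have "g \<circ> h \<in> G_grp d F"
    unfolding G_grp_def by (intro CollectI conjI tree_aut_comp[OF aut])
  moreover have "local_perm d (g \<circ> h) v \<in> F'" if v: "v \<in> tree_V d" for v
  proof -
    have "local_perm d g (h v) \<in> F'" "local_perm d h v \<in> F'"
      using g h v sub aut_tree_V[OF aut(2) v] by (auto simp: U_grp_def GFF_def)
    then show ?thesis
      unfolding local_perm_comp[OF aut v] by (rule perm_subgroup_comp[OF F'])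
  qed
  then have "g \<circ> h \<in> U_grp d F'"
    unfolding U_grp_def by (intro CollectI conjI tree_aut_comp[OF aut] ballI)
  ultimately show ?thesis
    by (simp add: GFF_def)
qed

lemma U_grp_subset_GFF:
  assumes "F \<subseteq> F'"
  shows "U_grp d F \<subseteq> GFF d F F'"
proof
  fix g assume g: "g \<in> U_grp d F"
  then have "{v \<in> tree_V d. local_perm d g v \<notin> F} = {}"
    unfolding U_grp_def by blast
  then have "finite {v \<in> tree_V d. local_perm d g v \<notin> F}"
    by (simp only: finite.emptyI)
  then show "g \<in> GFF d F F'"
    using g assms unfolding GFF_def G_grp_def U_grp_def by blast
qed

subsection \<open>The group topology\<close>

text \<open>The definition through \<open>topology\<close> yields these open sets only once the
  predicate is shown to be a topology; for intersections, the two finite sets of fixed vertices are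
  united.\<close>

lemma openin_GFF_topology:
  "openin (GFF_topology d F F') S \<longleftrightarrow> S \<subseteq> GFF d F F' \<and>
     (\<forall>g\<in>S. \<exists>A. finite A \<and> A \<subseteq> tree_V d \<and>
        (\<forall>h\<in>U_grp d F. (\<forall>a\<in>A. h a = a) \<longrightarrow> g \<circ> h \<in> S))"
proof -
  define P :: "(vert \<Rightarrow> vert) set \<Rightarrow> (vert \<Rightarrow> vert) \<Rightarrow> vert set \<Rightarrow> bool"
    where "P S g A \<longleftrightarrow> finite A \<and> A \<subseteq> tree_V d \<and>
      (\<forall>h\<in>U_grp d F. (\<forall>a\<in>A. h a = a) \<longrightarrow> g \<circ> h \<in> S)" for S g A
  have P_Int: "P (S \<inter> T) g (A \<union> B)" if "P S g A" "P T g B" for S T g A B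
    using that unfolding P_def by (meson Int_iff Un_iff Un_least finite_UnI)
  have P_mono: "P T g A" if "P S g A" "S \<subseteq> T" for S T g A
    using that unfolding P_def by (meson subsetD)
  have ist: "istopology (\<lambda>S. S \<subseteq> GFF d F F' \<and> (\<forall>g\<in>S. \<exists>A. P S g A))"
    unfolding istopology_def
  proof (intro conjI allI impI ballI)
    fix S T assume *: "S \<subseteq> GFF d F F' \<and> (\<forall>g\<in>S. \<exists>A. P S g A)"
      "T \<subseteq> GFF d F F' \<and> (\<forall>g\<in>T. \<exists>A. P T g A)"
    then show "S \<inter> T \<subseteq> GFF d F F'"
      by blast
    fix g assume "g \<in> S \<inter> T"
    then obtain A B where "P S g A" "P T g B"
      using * by blast
    then show "\<exists>A. P (S \<inter> T) g A"
      using P_Int by blast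
  next
    fix \<K> assume *: "\<forall>K\<in>\<K>. K \<subseteq> GFF d F F' \<and> (\<forall>g\<in>K. \<exists>A. P K g A)"
    then show "\<Union>\<K> \<subseteq> GFF d F F'"
      by blast
    fix g assume "g \<in> \<Union>\<K>"
    then obtain S A where "S \<in> \<K>" "P S g A"
      using * by blast
    then show "\<exists>A. P (\<Union>\<K>) g A"
      using P_mono by (meson Union_upper)
  qed
  have eq: "GFF_topology d F F' = topology (\<lambda>S. S \<subseteq> GFF d F F' \<and> (\<forall>g\<in>S. \<exists>A. P S g A))"
    unfolding GFF_topology_def P_def by (rule refl)
  show ?thesis
    unfolding eq topology_inverse'[OF ist] unfolding P_def by (rule refl)
qed

lemma openin_GFF_topologyI:
  assumes "S \<subseteq> GFF d F F'" "finite A" "A \<subseteq> tree_V d"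
    and inv: "\<And>g h. \<lbrakk>g \<in> S; h \<in> U_grp d F; \<forall>a\<in>A. h a = a\<rbrakk> \<Longrightarrow> g \<circ> h \<in> S"
  shows "openin (GFF_topology d F F') S"
  unfolding openin_GFF_topology
proof (intro conjI ballI)
  fix g assume "g \<in> S"
  with inv have *: "\<forall>h\<in>U_grp d F. (\<forall>a\<in>A. h a = a) \<longrightarrow> g \<circ> h \<in> S"
    by simp
  show "\<exists>A. finite A \<and> A \<subseteq> tree_V d \<and>
      (\<forall>h\<in>U_grp d F. (\<forall>a\<in>A. h a = a) \<longrightarrow> g \<circ> h \<in> S)"
    by (rule exI[of _ A], intro conjI assms(2,3) *)
qed (rule assms(1))

text \<open>If \<open>h\<close> fixes the root, then \<open>g\<close> and its right translate by
  \<open>h\<close> agree there, so the root alone serves as the finite vertex set. With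
  \<open>B = UNIV\<close> this also shows that the whole group is open.\<close>

lemma openin_GFF_base_vertex:
  assumes "perm_subgroup d F" "perm_subgroup d F'" "F \<subseteq> F'"
  shows "openin (GFF_topology d F F') {g \<in> GFF d F F'. g [] \<in> B}"
proof (rule openin_GFF_topologyI)
  show "finite {[]::vert}" "{[]} \<subseteq> tree_V d"
    by simp_all
  show "{g \<in> GFF d F F'. g [] \<in> B} \<subseteq> GFF d F F'"
    by (rule Collect_restrict)
next
  fix g h assume gh: "g \<in> {g \<in> GFF d F F'. g [] \<in> B}" "h \<in> U_grp d F" "\<forall>a\<in>{[]}. h a = a"
  from gh(3) have h: "h [] = []"
    by blast
  from gh(1) have "g \<in> GFF d F F'" "g [] \<in> B"
    by blast+
  moreover from this(1) gh(2) have "g \<circ> h \<in> GFF d F F'"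
    by (rule GFF_comp_U_grp[OF assms])
  ultimately show "g \<circ> h \<in> {g \<in> GFF d F F'. g [] \<in> B}"
    unfolding mem_Collect_eq o_apply h by (intro conjI)
qed

lemma topspace_GFF_topology:
  assumes "perm_subgroup d F" "perm_subgroup d F'" "F \<subseteq> F'"
  shows "topspace (GFF_topology d F F') = GFF d F F'"
proof
  show "topspace (GFF_topology d F F') \<subseteq> GFF d F F'"
    using openin_topspace[of "GFF_topology d F F'"] by (simp only: openin_GFF_topology)
  show "GFF d F F' \<subseteq> topspace (GFF_topology d F F')"
    using openin_subset[OF openin_GFF_base_vertex[OF assms, of UNIV]] by simp
qed

lemma continuous_map_base_vertex:
  assumes "perm_subgroup d F" "perm_subgroup d F'" "F \<subseteq> F'"
  shows "continuous_map (GFF_topology d F F') (discrete_topology UNIV) (\<lambda>g. g [])"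
  using openin_GFF_base_vertex[OF assms] topspace_GFF_topology[OF assms]
  by (simp add: continuous_map_def)

subsection \<open>Counting quasimorphisms\<close>

definition mark :: "(nat \<Rightarrow> nat) set \<Rightarrow> nat list \<Rightarrow> nat \<Rightarrow> bool" where
  "mark F w p \<longleftrightarrow> \<not> (\<exists>s\<in>F. s (w ! Suc p) = w ! Suc p \<and> s (w ! p) = w ! (p + 2))"

text \<open>A pattern of marks at distances \<open>0\<close>, \<open>2\<close>, \<open>2m + 6\<close> is counted positively, its reversal
  negatively; \<open>2m + 9\<close> is the number of letters involved, and the truncated subtraction in
  \<open>qm\<close> makes the sum empty for shorter words. Even distances suffice because every other
  position of the test words below is unmarked.\<close>

definition weight :: "(nat \<Rightarrow> nat) set \<Rightarrow> nat \<Rightarrow> nat list \<Rightarrow> nat \<Rightarrow> real" where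
  "weight F m w p =
     of_bool (mark F w p \<and> mark F w (p + 2) \<and> mark F w (p + 2 * m + 6))
   - of_bool (mark F w p \<and> mark F w (p + 2 * m + 4) \<and> mark F w (p + 2 * m + 6))"

definition qm :: "(nat \<Rightarrow> nat) set \<Rightarrow> nat \<Rightarrow> nat list \<Rightarrow> real" where
  "qm F m w = (\<Sum>p<Suc (length w) - (2 * m + 9). weight F m w p)"

lemma mark_Cons_Suc: "mark F (a # w) (Suc p) = mark F w p"
  by (simp add: mark_def)

lemma mark_append: "p + 2 < length x \<Longrightarrow> mark F (x @ y) p = mark F x p"
  by (simp add: mark_def nth_append)

lemma weight_Cons_Suc: "weight F m (a # w) (Suc p) = weight F m w p"
  by (simp only: weight_def add_Suc mark_Cons_Suc)

lemma weight_append: "p + 2 * m + 8 < length x \<Longrightarrow> weight F m (x @ y) p = weight F m x p"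
  by (simp add: weight_def mark_append)

lemma abs_weight_le: "\<bar>weight F m w p\<bar> \<le> 1"
  by (simp add: weight_def)

lemma qm_Nil [simp]: "qm F m [] = 0"
  by (simp add: qm_def)

lemma qm_Cons:
  "qm F m (a # w) = (if 2 * m + 8 \<le> length w then weight F m (a # w) 0 else 0) + qm F m w"
proof (cases "2 * m + 8 \<le> length w")
  case True
  then have "Suc (length (a # w)) - (2 * m + 9) = Suc (Suc (length w) - (2 * m + 9))"
    by simp
  then have "qm F m (a # w) =
      (\<Sum>p<Suc (Suc (length w) - (2 * m + 9)). weight F m (a # w) p)"
    by (simp only: qm_def)
  then show ?thesis
    using True by (simp only: sum.lessThan_Suc_shift weight_Cons_Suc qm_def if_True)
qed (simp add: qm_def)

text \<open>Only windows of \<open>2m + 9\<close> letters that straddle the cut matter, and there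
  are at most \<open>2m + 8\<close> of them. The minimum suits the induction: prepending a letter
  adds an error of at most 1 while \<open>x\<close> is short and none later.\<close>

lemma qm_append_bound:
  "\<bar>qm F m (x @ y) - qm F m x - qm F m y\<bar> \<le> real (min (length x) (2 * m + 8))"
proof (induction x)
  case (Cons a x)
  show ?case
  proof (cases "2 * m + 8 \<le> length x")
    case True
    then have "weight F m ((a # x) @ y) 0 = weight F m (a # x) 0"
      by (intro weight_append) simp
    then show ?thesis
      using Cons.IH True by (simp add: qm_Cons)
  next
    case False
    then have "real (min (length (a # x)) (2 * m + 8)) = real (min (length x) (2 * m + 8)) + 1"
      by simp
    then show ?thesis
      using Cons.IH False abs_weight_le[of F m "a # x @ y" 0] by (auto simp: qm_Cons)
  qed
qed simp

lemma qm_append: "\<bar>qm F m (x @ y) - qm F m x - qm F m y\<bar> \<le> real (2 * m + 8)"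
  using qm_append_bound[of F m x y] by linarith

text \<open>Lying in one orbit of the stabiliser of the middle letter is a symmetric relation, by
  inverses in \<open>F\<close>. The length condition says that the triples at \<open>p\<close> and
  at \<open>q\<close> correspond under reversal.\<close>

lemma mark_rev:
  assumes F: "perm_subgroup d F" and len: "length w = p + q + 3"
  shows "mark F (rev w) p = mark F w q"
proof -
  have nth: "rev w ! p = w ! (q + 2)" "rev w ! Suc p = w ! Suc q" "rev w ! (p + 2) = w ! q"
    using len by (simp_all add: rev_nth)
  have sym: "\<exists>s\<in>F. s y = y \<and> s z = x" if s: "s \<in> F" "s y = y" "s x = z" for s x y z
  proof
    have "bij s"
      using perm_subgroup_permutes[OF F s(1)] by (rule permutes_bij)
    then show "inv s y = y \<and> inv s z = x"
      using s(2,3) by (metis bij_inv_eq_iff)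
  qed (rule perm_subgroup_inv[OF F s(1)])
  show ?thesis
    unfolding mark_def nth using sym by metis
qed

text \<open>Reversal exchanges the patterns \<open>0, 2, 2m + 6\<close> and
  \<open>0, 2m + 4, 2m + 6\<close>, which carry opposite signs.\<close>

lemma weight_rev:
  assumes F: "perm_subgroup d F" and len: "length w = p + q + 2 * m + 9"
  shows "weight F m (rev w) p = - weight F m w q"
proof -
  have "mark F (rev w) p = mark F w (q + 2 * m + 6)"
    "mark F (rev w) (p + 2) = mark F w (q + 2 * m + 4)"
    "mark F (rev w) (p + 2 * m + 4) = mark F w (q + 2)"
    "mark F (rev w) (p + 2 * m + 6) = mark F w q"
    by (rule mark_rev[OF F], use len in simp)+
  then show ?thesis
    by (auto simp: weight_def)
qed

lemma qm_rev:
  assumes F: "perm_subgroup d F"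
  shows "qm F m (rev w) = - qm F m w"
proof -
  let ?n = "Suc (length w) - (2 * m + 9)"
  have "qm F m (rev w) = (\<Sum>p<?n. weight F m (rev w) p)"
    by (simp add: qm_def)
  also have "\<dots> = (\<Sum>p<?n. - weight F m w (?n - Suc p))"
    by (intro sum.cong refl weight_rev[OF F]) simp
  also have "\<dots> = - qm F m w"
    using sum.nat_diff_reindex[of "weight F m w" ?n] by (simp only: sum_negf qm_def)
  finally show ?thesis .
qed

text \<open>Up to a bounded error \<open>cnt F m u v\<close> is \<open>qm F m v - qm F m u\<close>, which is not invariant;
  hence the coboundary of \<open>cnt\<close> is bounded.\<close>

definition cnt :: "(nat \<Rightarrow> nat) set \<Rightarrow> nat \<Rightarrow> vert \<Rightarrow> vert \<Rightarrow> real" where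
  "cnt F m u v = qm F m (mul (rev u) v)"

text \<open>The common prefix \<open>p\<close> cancels from the difference, and
  \<open>qm_rev\<close> turns the negative count of \<open>a\<close> into the count of
  \<open>rev a\<close>. Splitting \<open>u\<close>, \<open>v\<close> and \<open>rev a @ b\<close>
  costs \<open>2m + 8\<close> each.\<close>

lemma cnt_approx:
  assumes F: "perm_subgroup d F" and uv: "u \<in> tree_V d" "v \<in> tree_V d"
  shows "\<bar>cnt F m u v - (qm F m v - qm F m u)\<bar> \<le> 3 * real (2 * m + 8)"
proof -
  obtain p a b where dec: "u = p @ a" "v = p @ b" "mul (rev u) v = rev a @ b"
    using uv by (rule mul_rev_decomp)
  have "cnt F m u v = qm F m (rev a @ b)"
    by (simp only: cnt_def dec(3))
  then show ?thesis
    using qm_append[of F m p a] qm_append[of F m p b] qm_append[of F m "rev a" b]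
    unfolding dec(1,2) qm_rev[OF F] by argo
qed

lemma cnt_coboundary_bound:
  assumes F: "perm_subgroup d F" and "u \<in> tree_V d" "v \<in> tree_V d" "w \<in> tree_V d"
  shows "\<bar>cnt F m v w - cnt F m u w + cnt F m u v\<bar> \<le> 9 * real (2 * m + 8)"
  using cnt_approx[OF F assms(3,4), of m] cnt_approx[OF F assms(2,4), of m]
    cnt_approx[OF F assms(2,3), of m] by linarith

text \<open>Two consecutive edges of the path meet in a vertex, and the local permutation there
  recolours both. The last conjunct strengthens the induction: the final edge is recoloured by the
  local permutation at the end of the path, the same one that will recolour the next edge.\<close>

lemma U_grp_path:
  assumes F: "perm_subgroup d F" and g: "g \<in> U_grp d F" and u: "u \<in> tree_V d" and "w \<in> tree_V d"
  shows "\<exists>w'\<in>tree_V d. length w' = length w \<and> g (mul u w) = mul (g u) w' \<and>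
    (\<forall>k. Suc k < length w \<longrightarrow> (\<exists>p\<in>F. w' ! k = p (w ! k) \<and> w' ! Suc k = p (w ! Suc k))) \<and>
    (w \<noteq> [] \<longrightarrow> last w' = local_perm d g (mul u w) (last w))"
  using \<open>w \<in> tree_V d\<close>
proof (induction w rule: rev_induct)
  case Nil
  then show ?case
    by (intro bexI[of _ "[]"]) simp_all
next
  case (snoc i w)
  then have w: "w \<in> tree_V d" and i: "i \<in> {1..d}" and ne: "w = [] \<or> last w \<noteq> i"
    by (simp_all add: snoc_in_tree_V)
  obtain w' where w': "w' \<in> tree_V d" "length w' = length w" "g (mul u w) = mul (g u) w'"
      "\<forall>k. Suc k < length w \<longrightarrow> (\<exists>p\<in>F. w' ! k = p (w ! k) \<and> w' ! Suc k = p (w ! Suc k))"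
      "w \<noteq> [] \<longrightarrow> last w' = local_perm d g (mul u w) (last w)"
    using snoc.IH[OF w] by blast
  define x where "x = mul u w"
  define p where "p = local_perm d g x"
  have aut: "g \<in> tree_aut d"
    using g by (simp add: U_grp_def)
  have x: "x \<in> tree_V d"
    using u w by (simp add: x_def mul_tree_V)
  have p: "p \<in> F"
    using g x by (simp add: U_grp_def p_def)
  then have "inj p"
    using permutes_inj[OF perm_subgroup_permutes[OF F]] by blast
  then have reduced: "w' = [] \<or> last w' \<noteq> p i"
    using ne w'(2,5) unfolding p_def x_def by (metis injD length_0_conv)
  let ?w' = "w' @ [p i]"
  have "?w' \<in> tree_V d"
    using w'(1) reduced aut_nbr(3)[OF aut x i] by (simp add: snoc_in_tree_V p_def)
  moreover have "g (mul u (w @ [i])) = mul (g u) ?w'"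
    using aut_nbr(1)[OF aut x i] w'(3) by (simp add: p_def x_def)
  moreover have "last ?w' = local_perm d g (mul u (w @ [i])) (last (w @ [i]))"
    using aut_nbr(2)[OF aut x i] by (simp add: p_def x_def)
  moreover have "\<exists>p\<in>F. ?w' ! k = p ((w @ [i]) ! k) \<and> ?w' ! Suc k = p ((w @ [i]) ! Suc k)"
    if k: "Suc k < length (w @ [i])" for k
  proof (cases "Suc k < length w")
    case True
    then show ?thesis
      using w'(2,4) by (simp add: nth_append)
  next
    case False
    with k have len: "length w = Suc k"
      by simp
    then have "w \<noteq> []" "w' \<noteq> []"
      using w'(2) by auto
    then have "w' ! k = p (w ! k)"
      using w'(2,5) len by (simp add: last_conv_nth p_def x_def)
    then show ?thesis
      using len w'(2) p by (intro bexI[of _ p]) (simp_all add: nth_append)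
  qed
  ultimately show ?case
    using w'(2) by (intro bexI[of _ ?w']) simp_all
qed

text \<open>\<open>p\<close> and \<open>q\<close> agree on the middle letter. Therefore composing
  with \<open>q\<close> on one side and \<open>inv p\<close> on the other carries an element that
  prevents a mark in \<open>w\<close> to one for \<open>w'\<close>, and conversely.\<close>

lemma mark_invariant:
  assumes F: "perm_subgroup d F"
    and p: "p \<in> F" "w' ! k = p (w ! k)" "w' ! Suc k = p (w ! Suc k)"
    and q: "q \<in> F" "w' ! Suc k = q (w ! Suc k)" "w' ! (k + 2) = q (w ! (k + 2))"
  shows "mark F w' k = mark F w k"
proof -
  have bij: "bij p" "bij q"
    using perm_subgroup_permutes[OF F] p(1) q(1) permutes_bij by blast+
  have "mark F w k" if "mark F w' k"
    unfolding mark_def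
  proof
    assume "\<exists>s\<in>F. s (w ! Suc k) = w ! Suc k \<and> s (w ! k) = w ! (k + 2)"
    then obtain s where s: "s \<in> F" "s (w ! Suc k) = w ! Suc k" "s (w ! k) = w ! (k + 2)"
      by blast
    have "q \<circ> s \<circ> inv p \<in> F"
      using F p(1) q(1) s(1) by (simp add: perm_subgroup_comp perm_subgroup_inv)
    moreover have "(q \<circ> s \<circ> inv p) (w' ! Suc k) = w' ! Suc k"
      using s(2) bij_is_inj[OF bij(1)] q(2) p(3) by (metis comp_apply inv_f_f)
    moreover have "(q \<circ> s \<circ> inv p) (w' ! k) = w' ! (k + 2)"
      using s(3) bij_is_inj[OF bij(1)] q(3) p(2) by (metis comp_apply inv_f_f)
    ultimately show False
      using that unfolding mark_def by blast
  qed
  moreover have "mark F w' k" if "mark F w k"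
    unfolding mark_def
  proof
    assume "\<exists>s\<in>F. s (w' ! Suc k) = w' ! Suc k \<and> s (w' ! k) = w' ! (k + 2)"
    then obtain s where s: "s \<in> F" "s (w' ! Suc k) = w' ! Suc k" "s (w' ! k) = w' ! (k + 2)"
      by blast
    have "inv q \<circ> s \<circ> p \<in> F"
      using F p(1) q(1) s(1) by (simp add: perm_subgroup_comp perm_subgroup_inv)
    moreover have "(inv q \<circ> s \<circ> p) (w ! Suc k) = w ! Suc k"
      using s(2) bij_is_inj[OF bij(2)] q(2) p(3) by (metis comp_apply inv_f_f)
    moreover have "(inv q \<circ> s \<circ> p) (w ! k) = w ! (k + 2)"
      using s(3) bij_is_inj[OF bij(2)] q(3) p(2) by (metis comp_apply inv_f_f)
    ultimately show False
      using that unfolding mark_def by blast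
  qed
  ultimately show ?thesis
    by blast
qed

lemma cnt_invariant:
  assumes F: "perm_subgroup d F" and g: "g \<in> U_grp d F" and uv: "u \<in> tree_V d" "v \<in> tree_V d"
  shows "cnt F m (g u) (g v) = cnt F m u v"
proof -
  define w where "w = mul (rev u) v"
  have w: "w \<in> tree_V d" "v = mul u w"
    using uv by (simp_all add: w_def mul_tree_V mul_rev_cancel)
  obtain w' where w': "w' \<in> tree_V d" "length w' = length w" "g v = mul (g u) w'"
    and col: "\<And>k. Suc k < length w \<Longrightarrow> \<exists>p\<in>F. w' ! k = p (w ! k) \<and> w' ! Suc k = p (w ! Suc k)"
    using U_grp_path[OF F g uv(1) w(1)] w(2) by blast
  have gu: "g u \<in> tree_V d"
    using g uv(1) by (simp add: U_grp_def aut_tree_V)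
  have mark: "mark F w' k = mark F w k" if "k + 2 < length w" for k
    using col[of k] col[of "Suc k"] that mark_invariant[OF F] by fastforce
  have "weight F m w' k = weight F m w k" if "k + 2 * m + 8 < length w" for k
    using that mark by (simp add: weight_def)
  then have "qm F m w' = qm F m w"
    unfolding qm_def w'(2) by (intro sum.cong) simp_all
  moreover have "mul (rev (g u)) (g v) = w'"
    using gu w'(1) by (simp add: w'(3) mul_rev_cancel)
  ultimately show ?thesis
    by (simp add: cnt_def w_def)
qed

subsection \<open>Test words\<close>

text \<open>Otherwise every point stabiliser is transitive on the other points; together with
  transitivity of \<open>F\<close> this gives 2-transitivity.\<close>

lemma not_two_transitive_witness:
  assumes F: "perm_subgroup d F" and d: "3 \<le> d" and nt: "\<not> two_transitive d F"
  obtains a b c where "a \<in> {1..d}" "b \<in> {1..d}" "c \<in> {1..d}" "a \<noteq> b" "c \<noteq> b"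
    "\<forall>s\<in>F. s b = b \<longrightarrow> s a \<noteq> c"
proof (rule ccontr)
  assume "\<not> thesis"
  with that have stab: "\<exists>s\<in>F. s b = b \<and> s a = c"
    if "a \<in> {1..d}" "b \<in> {1..d}" "c \<in> {1..d}" "a \<noteq> b" "c \<noteq> b" for a b c
    using that by metis
  have trans: "\<exists>s\<in>F. s x = y" if "x \<in> {1..d}" "y \<in> {1..d}" for x y
  proof -
    \<comment> \<open>Since there are at least three points, some \<open>z\<close> differs from
      both, and its stabiliser moves \<open>x\<close> to \<open>y\<close>.\<close>
    have "\<not> {1..d} \<subseteq> {x, y}"
      using d card_mono[of "{x, y}" "{1..d}"] by (auto simp: card_insert_if split: if_splits)
    then obtain z where "z \<in> {1..d}" "x \<noteq> z" "y \<noteq> z"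
      by blast
    then show ?thesis
      using stab that by blast
  qed
  have "two_transitive d F"
    unfolding two_transitive_def
  proof (intro ballI impI)
    fix x y x' y' assume in_d: "x \<in> {1..d}" "y \<in> {1..d}" "x' \<in> {1..d}" "y' \<in> {1..d}"
      and ne: "x \<noteq> y" "x' \<noteq> y'"
    obtain s where s: "s \<in> F" "s x = x'"
      using trans in_d by blast
    have "s permutes {1..d}"
      using F s(1) by (rule perm_subgroup_permutes)
    then have "s y \<in> {1..d}" "s y \<noteq> x'"
      using in_d ne s(2) by (auto simp: permutes_in_image dest: permutes_inj injD simp del: atLeastAtMost_iff)
    then obtain t where t: "t \<in> F" "t x' = x'" "t (s y) = y'"
      using stab[of "s y" x' y'] in_d ne by metis
    then show "\<exists>p\<in>F. p x = x' \<and> p y = y'"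
      using s F by (intro bexI[of _ "t \<circ> s"]) (simp_all add: perm_subgroup_comp)
  qed
  with nt show False ..
qed

primrec alternation :: "nat \<Rightarrow> nat \<Rightarrow> nat set \<Rightarrow> nat \<Rightarrow> nat" where
  "alternation a c S 0 = a"
| "alternation a c S (Suc s) =
    (if s \<in> S then if alternation a c S s = a then c else a else alternation a c S s)"

lemma alternation_cases: "alternation a c S s = a \<or> alternation a c S s = c"
  by (induction s) auto

definition star_word :: "nat \<Rightarrow> nat \<Rightarrow> nat \<Rightarrow> nat set \<Rightarrow> nat \<Rightarrow> nat list" where
  "star_word a b c S n = map (\<lambda>i. if even i then alternation a c S (i div 2) else b) [0..<n]"

lemma star_word_in_tree_V:
  assumes "a \<in> {1..d}" "b \<in> {1..d}" "c \<in> {1..d}" "a \<noteq> b" "c \<noteq> b"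
  shows "star_word a b c S n \<in> tree_V d"
proof -
  have alt: "alternation a c S s \<in> {1..d}" "alternation a c S s \<noteq> b" for s
    using alternation_cases[of a c S s] assms by auto
  have "set (star_word a b c S n) \<subseteq> {1..d}"
    using assms(2) alt(1) by (auto simp: star_word_def)
  moreover have "star_word a b c S n ! i \<noteq> star_word a b c S n ! Suc i" if "Suc i < n" for i
    using that assms(4,5) alt(2) alt(2)[symmetric] by (simp add: star_word_def)
  ultimately show ?thesis
    by (simp add: tree_V_def) (simp add: star_word_def)
qed

lemma not_mark_return:
  assumes "id \<in> F" "w ! p = w ! (p + 2)"
  shows "\<not> mark F w p"
  using bexI[of "\<lambda>s. s (w ! Suc p) = w ! Suc p \<and> s (w ! p) = w ! (p + 2)", OF _ assms(1)] assms(2)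
  unfolding mark_def by simp

text \<open>A triple at an odd position begins and ends with \<open>b\<close>, so the identity
  prevents a mark. At position \<open>2s\<close> the outer letters are equal unless \<open>s\<close>
  lies in \<open>S\<close>; then they are \<open>a\<close> and \<open>c\<close> in some order, and
  \<open>sep\<close> separates both orders, by inverses.\<close>

lemma mark_star_word:
  assumes F: "perm_subgroup d F" and sep: "\<forall>s\<in>F. s b = b \<longrightarrow> s a \<noteq> c"
    and p: "p + 2 < n"
  shows "mark F (star_word a b c S n) p \<longleftrightarrow> even p \<and> p div 2 \<in> S"
proof -
  let ?w = "star_word a b c S n" and ?x = "alternation a c S"
  have id: "id \<in> F"
    using F by (rule perm_subgroup_id)
  have sep': "s c \<noteq> a" if s: "s \<in> F" "s b = b" for s
  proof
    assume "s c = a"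
    then have "inv s b = b" "inv s a = c"
      using s permutes_inv_eq[OF perm_subgroup_permutes[OF F s(1)]] by simp_all
    then show False
      using sep perm_subgroup_inv[OF F s(1)] by blast
  qed
  show ?thesis
  proof (cases "even p")
    case False
    then have "?w ! p = b" "?w ! (p + 2) = b"
      using p by (simp_all add: star_word_def)
    then have "\<not> mark F ?w p"
      by (simp only: not_mark_return[OF id] not_False_eq_True)
    then show ?thesis
      using False by simp
  next
    case True
    then obtain s where s: "p = 2 * s"
      by blast
    have w: "?w ! p = ?x s" "?w ! Suc p = b" "?w ! (p + 2) = ?x (Suc s)"
      using p by (simp_all add: star_word_def s)
    show ?thesis
    proof (cases "s \<in> S")
      case False
      then have "\<not> mark F ?w p"
        by (intro not_mark_return[OF id]) (simp only: w alternation.simps if_False)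
      then show ?thesis
        using False s by simp
    next
      case True
      have "a \<noteq> c"
        using sep id by auto
      then have "mark F ?w p"
        using alternation_cases[of a c S s] True sep sep' unfolding mark_def w by auto
      then show ?thesis
        using True s by simp
    qed
  qed
qed

text \<open>The marks of the test words repeat with the period \<open>P\<close>, which is so long that no pattern
  counted by \<^term>\<open>qm F m\<close> with \<open>m < n\<close> meets the marks of two periods.\<close>

lemma star_word_qm:
  assumes F: "perm_subgroup d F" and sep: "\<forall>s\<in>F. s b = b \<longrightarrow> s a \<noteq> c" and j: "j < n"
  obtains S N where "real k \<le> qm F j (star_word a b c S N)"
    "\<forall>m<n. m \<noteq> j \<longrightarrow> qm F m (star_word a b c S N) = 0"
proof -
  define P where "P = 2 * n + 20"
  \<comment> \<open>The residues \<open>0, 1, j + 3\<close> are half the distances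
    \<open>0, 2, 2j + 6\<close> of the pattern counted positively for \<open>j\<close>.\<close>
  define S where "S = {s. s mod P \<in> {0, 1, j + 3}}"
  \<comment> \<open>With this length exactly \<open>2Pk + 1\<close> windows of \<open>2j + 9\<close>
    letters fit, so all starts \<open>2Pt\<close> with \<open>t < k\<close> are available.\<close>
  define N where "N = 2 * P * k + 2 * j + 9"
  let ?w = "star_word a b c S N"
  have len: "length ?w = N"
    by (simp add: star_word_def)
  have P_pos: "0 < P"
    by (simp add: P_def)
  have mod: "(s + e) mod P = (if s mod P + e < P then s mod P + e else s mod P + e - P)"
    if "e < P" for s e
  proof -
    have "s mod P < P"
      by (simp add: P_pos)
    then have "s mod P + e - P < P"
      using that by linarith
    then show ?thesis
      using mod_add_left_eq[of s P e] by (simp add: mod_if[of "s mod P + e"] split: if_splits)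
  qed
  \<comment> \<open>Only the residues 0 and 1 are adjacent, which forces residue 0 for
    \<open>s\<close>; then \<open>m + 3\<close> must be the residue \<open>j + 3\<close>.\<close>
  have fwd: "s mod P = 0 \<and> m = j"
    if "s \<in> S" "s + 1 \<in> S" "s + m + 3 \<in> S" "m < n" for s m
  proof -
    have r: "s mod P \<in> {0, 1, j + 3}" "(s + 1) mod P \<in> {0, 1, j + 3}"
        "(s + (m + 3)) mod P \<in> {0, 1, j + 3}"
      using that by (simp_all only: S_def mem_Collect_eq add.assoc)
    have "s mod P = 0"
      using r(1,2) mod[of 1 s] j by (auto simp: P_def split: if_splits)
    moreover from this have "m = j"
      using r(3) mod[of "m + 3" s] j that(4) by (auto simp: P_def split: if_splits)
    ultimately show ?thesis ..
  qed
  \<comment> \<open>There is no wrap-around modulo \<open>P\<close>, and the adjacent residues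
    needed at the end would both be at least 2.\<close>
  have bwd: False if "s \<in> S" "s + m + 2 \<in> S" "s + m + 3 \<in> S" "m < n" for s m
  proof -
    have r: "s mod P \<in> {0, 1, j + 3}" "(s + (m + 2)) mod P \<in> {0, 1, j + 3}"
        "(s + (m + 3)) mod P \<in> {0, 1, j + 3}"
      using that by (simp_all only: S_def mem_Collect_eq add.assoc)
    have "s mod P + m + 3 < P"
      using r(1) j that(4) by (auto simp: P_def)
    then have "s mod P + (m + 2) \<in> {0, 1, j + 3}" "s mod P + (m + 3) \<in> {0, 1, j + 3}"
      using r(2,3) mod[of "m + 2" s] mod[of "m + 3" s] by simp_all
    then show False
      by auto
  qed
  have weight: "weight F m ?w p = of_bool (m = j \<and> 2 * P dvd p)"
    if m: "m < n" and p: "p < Suc N - (2 * m + 9)" for m p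
  proof -
    have mark: "mark F ?w (p + e) \<longleftrightarrow> even (p + e) \<and> (p + e) div 2 \<in> S" if "e \<le> 2 * m + 6" for e
      using p that by (intro mark_star_word[OF F sep]) auto
    show ?thesis
    proof (cases "even p")
      case False
      then have "\<not> mark F ?w p" "\<not> 2 * P dvd p"
        using mark[of 0] by (auto dest: dvd_mult_left)
      then show ?thesis
        by (simp add: weight_def)
    next
      case True
      then obtain s where s: "p = 2 * s"
        by blast
      have marks: "mark F ?w p \<longleftrightarrow> s \<in> S" "mark F ?w (p + 2) \<longleftrightarrow> s + 1 \<in> S"
        "mark F ?w (p + 2 * m + 4) \<longleftrightarrow> s + m + 2 \<in> S"
        "mark F ?w (p + 2 * m + 6) \<longleftrightarrow> s + m + 3 \<in> S"
        using mark[of 0] mark[of 2] mark[of "2 * m + 4"] mark[of "2 * m + 6"]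
        by (simp_all add: s add.assoc)
      have "s \<in> S \<and> s + 1 \<in> S \<and> s + m + 3 \<in> S \<longleftrightarrow> m = j \<and> P dvd s"
      proof
        assume "m = j \<and> P dvd s"
        then have "s mod P = 0" and m_eq: "m = j"
          by simp_all
        then have "(s + 1) mod P = 1" "(s + (m + 3)) mod P = j + 3"
          using mod[of 1 s] mod[of "m + 3" s] j by (simp_all add: P_def)
        then show "s \<in> S \<and> s + 1 \<in> S \<and> s + m + 3 \<in> S"
          using \<open>s mod P = 0\<close> by (simp add: S_def add.assoc)
      next
        assume "s \<in> S \<and> s + 1 \<in> S \<and> s + m + 3 \<in> S"
        then show "m = j \<and> P dvd s"
          using fwd[of s m] m by (simp add: dvd_eq_mod_eq_0)
      qed
      moreover have "\<not> (s \<in> S \<and> s + m + 2 \<in> S \<and> s + m + 3 \<in> S)"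
        using bwd m by blast
      moreover have "2 * P dvd p \<longleftrightarrow> P dvd s"
        by (simp add: s)
      ultimately show ?thesis
        unfolding weight_def marks by simp
    qed
  qed
  have "qm F m ?w = 0" if "m < n" "m \<noteq> j" for m
    unfolding qm_def len using weight[OF that(1)] that(2) by (intro sum.neutral) simp
  moreover have "real k \<le> qm F j ?w"
  proof -
    have bound: "Suc N - (2 * j + 9) = 2 * P * k + 1"
      by (simp add: N_def)
    have "real k = real (card ((\<lambda>t. 2 * P * t) ` {..<k}))"
      using P_pos by (subst card_image) (simp_all add: inj_on_def)
    also have "\<dots> \<le> real (card {p \<in> {..<2 * P * k + 1}. 2 * P dvd p})"
    proof -
      have "(\<lambda>t. 2 * P * t) ` {..<k} \<subseteq> {p \<in> {..<2 * P * k + 1}. 2 * P dvd p}"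
      proof
        fix p assume "p \<in> (\<lambda>t. 2 * P * t) ` {..<k}"
        then obtain t where t: "t < k" "p = 2 * P * t"
          by blast
        then have "p \<le> 2 * P * k"
          by simp
        then have "p < 2 * P * k + 1"
          by linarith
        then show "p \<in> {p \<in> {..<2 * P * k + 1}. 2 * P dvd p}"
          using t(2) by simp
      qed
      then have "card ((\<lambda>t. 2 * P * t) ` {..<k}) \<le> card {p \<in> {..<2 * P * k + 1}. 2 * P dvd p}"
        by (intro card_mono) simp_all
      then show ?thesis
        by (simp only: of_nat_le_iff)
    qed
    also have "\<dots> = (\<Sum>p<2 * P * k + 1. of_bool (2 * P dvd p))"
      by (simp only: sum_of_bool_eq finite_lessThan Collect_conj_eq Collect_mem_eq)
    also have "\<dots> = qm F j ?w"
      unfolding qm_def len bound using weight[OF j] bound by (intro sum.cong) simp_all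
    finally show ?thesis .
  qed
  ultimately show thesis
    using that by blast
qed

subsection \<open>Cocycles on the group\<close>

text \<open>The orbit map of the root is continuous into a discrete space, and products of discrete
  spaces are discrete, so any \<open>K\<close> will do.\<close>

lemma continuous_map_base_vertex3:
  assumes "perm_subgroup d F" "perm_subgroup d F'" "F \<subseteq> F'"
  shows "continuous_map (prod_topology (GFF_topology d F F')
      (prod_topology (GFF_topology d F F') (GFF_topology d F F'))) euclideanreal
    (\<lambda>(x, y, z). K (x []) (y []) (z []) :: real)"
proof -
  let ?X = "GFF_topology d F F'" and ?D = "discrete_topology (UNIV :: vert set)"
  let ?Z = "prod_topology ?X (prod_topology ?X ?X)"
  let ?\<pi> = "\<lambda>t. (((\<lambda>g. g []) \<circ> fst) t, ((\<lambda>g. g []) \<circ> (fst \<circ> snd)) t, ((\<lambda>g. g []) \<circ> (snd \<circ> snd)) t)"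
  note base = continuous_map_base_vertex[OF assms]
  have fst: "continuous_map ?Z ?X fst" and snd: "continuous_map ?Z (prod_topology ?X ?X) snd"
    by (rule continuous_map_fst continuous_map_snd)+
  have "continuous_map ?Z (prod_topology ?D (prod_topology ?D ?D)) ?\<pi>"
    by (intro continuous_map_pairedI continuous_map_compose[OF fst base]
        continuous_map_compose[OF continuous_map_fst_of[OF snd] base]
        continuous_map_compose[OF continuous_map_snd_of[OF snd] base])
  moreover have "prod_topology ?D (prod_topology ?D ?D) = discrete_topology UNIV"
    by (simp add: prod_topology_discrete_topology[symmetric])
  ultimately have \<pi>: "continuous_map ?Z (discrete_topology UNIV) ?\<pi>"
    by (simp only:)
  have "continuous_map (discrete_topology UNIV) euclideanreal (\<lambda>(u, v, w). K u v w :: real)"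
    by simp
  from continuous_map_compose[OF \<pi> this] show ?thesis
    by (simp only: o_def case_prod_unfold fst_conv snd_conv)
qed

definition cnt_cochain :: "(nat \<Rightarrow> nat) set \<Rightarrow> nat \<Rightarrow> (vert \<Rightarrow> vert) \<times> (vert \<Rightarrow> vert) \<Rightarrow> real" where
  "cnt_cochain F m = (\<lambda>(g, h). cnt F m (g []) (h []))"

lemma GFF_base_vertex: "g \<in> GFF d F F' \<Longrightarrow> g [] \<in> tree_V d"
  by (simp add: GFF_def G_grp_def aut_tree_V)

text \<open>Marks are taken with respect to \<open>F'\<close> because invariance is required under
  all of \<open>G(F,F')\<close>, which lies in \<open>U(F')\<close> but need not lie in
  \<open>U(F)\<close>.\<close>

lemma cobd1_cnt_cochain_cocycle:
  assumes F: "perm_subgroup d F" and F': "perm_subgroup d F'" and sub: "F \<subseteq> F'"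
  shows "cobd1 (cnt_cochain F' m) \<in> cb_cocycle2 (GFF_topology d F F') (\<circ>)"
proof -
  let ?X = "GFF_topology d F F'" and ?f = "cobd1 (cnt_cochain F' m)"
  note space = topspace_GFF_topology[OF assms]
  have f: "?f = (\<lambda>(x, y, z). (\<lambda>u v w. cnt F' m v w - cnt F' m u w + cnt F' m u v) (x []) (y []) (z []))"
    by (simp add: cobd1_def cnt_cochain_def)
  have cont: "continuous_map (prod_topology ?X (prod_topology ?X ?X)) euclideanreal ?f"
    unfolding f by (rule continuous_map_base_vertex3[OF assms])
  have bdd: "bounded (?f ` (topspace ?X \<times> topspace ?X \<times> topspace ?X))"
    unfolding bounded_iff
  proof (intro exI ballI)
    fix r assume "r \<in> ?f ` (topspace ?X \<times> topspace ?X \<times> topspace ?X)"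
    then obtain x y z where xyz: "x \<in> GFF d F F'" "y \<in> GFF d F F'" "z \<in> GFF d F F'"
      and r: "r = ?f (x, y, z)"
      unfolding space by (elim imageE SigmaE) simp
    show "norm r \<le> 9 * real (2 * m + 8)"
      using cnt_coboundary_bound[OF F' GFF_base_vertex[OF xyz(1)] GFF_base_vertex[OF xyz(2)]
          GFF_base_vertex[OF xyz(3)], of m]
      by (simp only: r f prod.case real_norm_def)
  qed
  have inv: "?f (g \<circ> x, g \<circ> y, g \<circ> z) = ?f (x, y, z)"
    if "g \<in> GFF d F F'" "x \<in> GFF d F F'" "y \<in> GFF d F F'" "z \<in> GFF d F F'" for g x y z
  proof -
    have "g \<in> U_grp d F'"
      using that(1) by (simp add: GFF_def)
    then have "cnt F' m (g (u [])) (g (v [])) = cnt F' m (u []) (v [])"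
      if "u \<in> GFF d F F'" "v \<in> GFF d F F'" for u v
      using that by (intro cnt_invariant[OF F'] GFF_base_vertex)
    then show ?thesis
      using that(2-4) by (simp only: f prod.case o_apply)
  qed
  have coc: "?f (y, z, t) - ?f (x, z, t) + ?f (x, y, t) - ?f (x, y, z) = 0" for x y z t
    by (simp add: f)
  show ?thesis
    unfolding cb_cocycle2_def cb_cochain2_def
    by (intro CollectI conjI ballI cont bdd coc) (simp only: space inv)
qed

text \<open>An invariant 1-cocycle on the free product of copies of \<open>Z/2\<close> is a homomorphism to the
  reals, hence kills the generators, which are involutions.\<close>

lemma invariant_cocycle_left_mul:
  fixes \<theta> :: "(vert \<Rightarrow> vert) \<times> (vert \<Rightarrow> vert) \<Rightarrow> real"
  assumes inv: "\<And>a b c. a \<in> tree_V d \<Longrightarrow> b \<in> tree_V d \<Longrightarrow> c \<in> tree_V d \<Longrightarrow>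
      \<theta> (left_mul d a \<circ> left_mul d b, left_mul d a \<circ> left_mul d c) = \<theta> (left_mul d b, left_mul d c)"
    and cocycle: "\<And>a b c. a \<in> tree_V d \<Longrightarrow> b \<in> tree_V d \<Longrightarrow> c \<in> tree_V d \<Longrightarrow>
      \<theta> (left_mul d b, left_mul d c) - \<theta> (left_mul d a, left_mul d c)
        + \<theta> (left_mul d a, left_mul d b) = 0"
    and w: "w \<in> tree_V d"
  shows "\<theta> (left_mul d [], left_mul d w) = 0"
  using w
proof (induction w rule: rev_induct)
  case Nil
  then show ?case
    using cocycle[of "[]" "[]" "[]"] by simp
next
  case (snoc i w)
  have w: "w \<in> tree_V d" and i: "[i] \<in> tree_V d"
    using snoc.prems snoc_in_tree_V[of "[]" i d] by (simp_all add: snoc_in_tree_V)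
  have Nil: "[] \<in> tree_V d"
    by simp
  have e: "left_mul d a \<circ> left_mul d [] = left_mul d a" for a
    by (simp add: left_mul_Nil_eq_id)
  have ii: "left_mul d [i] \<circ> left_mul d [i] = left_mul d []"
    using i by (simp add: left_mul_comp mul_Cons nbr_def)
  have wi: "left_mul d w \<circ> left_mul d [i] = left_mul d (w @ [i])"
    using w i snoc.prems by (simp add: left_mul_comp mul_eq_append)
  have zero: "\<theta> (left_mul d [], left_mul d []) = 0"
    using cocycle[OF Nil Nil Nil] by simp
  \<comment> \<open>Translating by the involution \<open>i\<close> swaps the two arguments, so the
    cocycle identity at \<open>[], [i], []\<close> says that twice the value on the generator is
    0.\<close>
  have "\<theta> (left_mul d [i], left_mul d []) = \<theta> (left_mul d [], left_mul d [i])"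
    using inv[OF i Nil i] by (simp only: e ii)
  then have gen: "\<theta> (left_mul d [], left_mul d [i]) = 0"
    using cocycle[OF Nil i Nil] zero by simp
  have "\<theta> (left_mul d w, left_mul d (w @ [i])) = \<theta> (left_mul d [], left_mul d [i])"
    using inv[OF w Nil i] by (simp only: e wi)
  then show ?case
    using cocycle[OF Nil w snoc.prems] snoc.IH[OF w] gen by simp
qed

lemma cnt_cochain_independent:
  assumes F: "perm_subgroup d F" and F': "perm_subgroup d F'" and sub: "F \<subseteq> F'"
    and abc: "a \<in> {1..d}" "b \<in> {1..d}" "c \<in> {1..d}" "a \<noteq> b" "c \<noteq> b"
    and sep: "\<forall>s\<in>F'. s b = b \<longrightarrow> s a \<noteq> c"
    and \<psi>: "\<psi> \<in> cb_cochain1 (GFF_topology d F F') (\<circ>)"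
    and eq: "\<And>x. x \<in> topspace (GFF_topology d F F') \<times> topspace (GFF_topology d F F')
          \<times> topspace (GFF_topology d F F') \<Longrightarrow>
        (\<Sum>i<n. \<gamma> i * cobd1 (cnt_cochain F' i) x) = cobd1 \<psi> x"
    and j: "j < n"
  shows "\<gamma> j = (0 :: real)"
proof -
  note space = topspace_GFF_topology[OF F F' sub]
  have L: "left_mul d u \<in> GFF d F F'" if "u \<in> tree_V d" for u
    using left_mul_U_grp[OF that perm_subgroup_id[OF F]] U_grp_subset_GFF[OF sub] by blast
  have LU: "left_mul d u \<in> U_grp d F'" if "u \<in> tree_V d" for u
    using left_mul_U_grp[OF that perm_subgroup_id[OF F']] .
  \<comment> \<open>Both parts have the same coboundary, so on left translations \<theta> is an
    invariant 1-cocycle and vanishes from the root. There the combination of counts equals the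
    bounded \<psi>.\<close>
  define \<theta> where "\<theta> x = (\<Sum>i<n. \<gamma> i * cnt_cochain F' i x) - \<psi> x" for x
  have "bounded (\<psi> ` (GFF d F F' \<times> GFF d F F'))"
    using \<psi> unfolding cb_cochain1_def space by blast
  then obtain M where *: "\<forall>r\<in>\<psi> ` (GFF d F F' \<times> GFF d F F'). norm r \<le> M"
    unfolding bounded_iff by blast
  have M: "\<bar>\<psi> (g, h)\<bar> \<le> M" if "g \<in> GFF d F F'" "h \<in> GFF d F F'" for g h
    using bspec[OF * imageI[OF SigmaI[OF that]]] by (simp only: real_norm_def)
  have \<theta>_zero: "\<theta> (left_mul d [], left_mul d w) = 0" if "w \<in> tree_V d" for w
  proof (rule invariant_cocycle_left_mul[OF _ _ that])
    fix u v w assume uvw: "u \<in> tree_V d" "v \<in> tree_V d" "w \<in> tree_V d"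
    have "\<psi> (left_mul d u \<circ> left_mul d v, left_mul d u \<circ> left_mul d w)
        = \<psi> (left_mul d v, left_mul d w)"
      using \<psi> L[OF uvw(1)] L[OF uvw(2)] L[OF uvw(3)] by (simp add: cb_cochain1_def space)
    moreover have "cnt_cochain F' i (left_mul d u \<circ> left_mul d v, left_mul d u \<circ> left_mul d w)
        = cnt_cochain F' i (left_mul d v, left_mul d w)" for i
      using cnt_invariant[OF F' LU[OF uvw(1)] uvw(2,3), of i] by (simp add: cnt_cochain_def)
    ultimately show "\<theta> (left_mul d u \<circ> left_mul d v, left_mul d u \<circ> left_mul d w)
        = \<theta> (left_mul d v, left_mul d w)"
      by (simp add: \<theta>_def)
    have "(\<Sum>i<n. \<gamma> i * cobd1 (cnt_cochain F' i) (left_mul d u, left_mul d v, left_mul d w))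
        = cobd1 \<psi> (left_mul d u, left_mul d v, left_mul d w)"
      by (rule eq) (simp add: space L uvw)
    then show "\<theta> (left_mul d v, left_mul d w) - \<theta> (left_mul d u, left_mul d w)
        + \<theta> (left_mul d u, left_mul d v) = 0"
      unfolding \<theta>_def cobd1_def prod.case distrib_left right_diff_distrib sum.distrib sum_subtractf
      by linarith
  qed
  have bound: "\<bar>\<Sum>i<n. \<gamma> i * qm F' i w\<bar> \<le> M" if w: "w \<in> tree_V d" for w
  proof -
    have "(\<Sum>i<n. \<gamma> i * qm F' i w) = \<psi> (left_mul d [], left_mul d w)"
      using \<theta>_zero[OF w] w by (simp add: \<theta>_def cnt_cochain_def cnt_def)
    then show ?thesis
      using M[OF L[OF Nil_in_tree_V] L[OF w]] by simp
  qed
  \<comment> \<open>A test word for \<open>j\<close> makes all other counts vanish and the count for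
    \<open>j\<close> at least \<open>k\<close>, while \<open>M\<close> does not depend on the
    word.\<close>
  have "\<bar>\<gamma> j\<bar> * real k \<le> M" for k
  proof -
    obtain S N where large: "real k \<le> qm F' j (star_word a b c S N)"
      and zero: "\<forall>m<n. m \<noteq> j \<longrightarrow> qm F' m (star_word a b c S N) = 0"
      using star_word_qm[OF F' sep j, where k = k] by blast
    let ?w = "star_word a b c S N"
    have "(\<Sum>i<n. \<gamma> i * qm F' i ?w) = (\<Sum>i<n. if i = j then \<gamma> j * qm F' j ?w else 0)"
      using zero by (intro sum.cong) simp_all
    also have "\<dots> = \<gamma> j * qm F' j ?w"
      using j by simp
    finally have sum_eq: "(\<Sum>i<n. \<gamma> i * qm F' i ?w) = \<gamma> j * qm F' j ?w" .
    have "\<bar>\<gamma> j * qm F' j ?w\<bar> \<le> M"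
      using bound[OF star_word_in_tree_V[OF abc, of S N]] unfolding sum_eq .
    moreover have "0 \<le> qm F' j ?w"
      using large of_nat_0_le_iff[of k] by linarith
    ultimately have "\<bar>\<gamma> j\<bar> * qm F' j ?w \<le> M"
      by (simp add: abs_mult)
    moreover have "\<bar>\<gamma> j\<bar> * real k \<le> \<bar>\<gamma> j\<bar> * qm F' j ?w"
      using large by (intro mult_left_mono) simp_all
    ultimately show ?thesis
      by linarith
  qed
  then have "\<not> M < real k * \<bar>\<gamma> j\<bar>" for k
    by (simp only: not_less mult.commute)
  then show ?thesis
    using reals_Archimedean3[of "\<bar>\<gamma> j\<bar>"] zero_less_abs_iff[of "\<gamma> j"] by blast
qed

theorem theorem1:
  fixes d :: nat and F F' :: "(nat \<Rightarrow> nat) set"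
  assumes "d \<ge> 3"
    and "perm_subgroup d F" and "perm_subgroup d F'"
    and "F \<subset> F'" and "F' \<subset> Sym d"
    and "preserves_orbits d F F'"
    and "\<not> two_transitive d F'"
  shows "H2cb_infinite_dim (GFF_topology d F F') (\<circ>)"
proof -
  have sub: "F \<subseteq> F'"
    using assms(4) by blast
  obtain a b c where abc: "a \<in> {1..d}" "b \<in> {1..d}" "c \<in> {1..d}" "a \<noteq> b" "c \<noteq> b"
      and sep: "\<forall>s\<in>F'. s b = b \<longrightarrow> s a \<noteq> c"
    using not_two_transitive_witness[OF assms(3,1,7)] by blast
  show ?thesis
    unfolding H2cb_infinite_dim_def
  proof (intro allI exI conjI impI)
    show "cobd1 (cnt_cochain F' i) \<in> cb_cocycle2 (GFF_topology d F F') (\<circ>)" for i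
      by (rule cobd1_cnt_cochain_cocycle[OF assms(2,3) sub])
  next
    fix n i and \<gamma> :: "nat \<Rightarrow> real"
    assume "\<exists>\<phi>\<in>cb_cochain1 (GFF_topology d F F') (\<circ>). \<forall>x\<in>topspace (GFF_topology d F F') \<times>
        topspace (GFF_topology d F F') \<times> topspace (GFF_topology d F F').
        (\<Sum>i<n. \<gamma> i * cobd1 (cnt_cochain F' i) x) = cobd1 \<phi> x" and i: "i < n"
    then obtain \<psi> where "\<psi> \<in> cb_cochain1 (GFF_topology d F F') (\<circ>)"
      "\<And>x. x \<in> topspace (GFF_topology d F F') \<times> topspace (GFF_topology d F F')
          \<times> topspace (GFF_topology d F F') \<Longrightarrow>
        (\<Sum>i<n. \<gamma> i * cobd1 (cnt_cochain F' i) x) = cobd1 \<psi> x"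
      by blast
    from this i show "\<gamma> i = 0"
      by (rule cnt_cochain_independent[OF assms(2,3) sub abc sep])
  qed
qed

end
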